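(* Let $U$ and $V$ be independent standard normal random variables, let $\phi\colon\mathbb{R}\to\mathbb{R}$ be Borel measurable, and let $\Gamma$ be the associated noise traders' expected loss (defined in the context). Then $$-\frac12\le\Gamma\le\frac12 .$$ Moreover, for each choice of sign, $\Gamma=\pm\tfrac12$ if and only if there exists $a\in\mathbb{R}$ such that $$\phi(v)=\pm v+a\qquad\text{for Lebesgue-almost every }v\in\mathbb{R},$$ with the same choice of sign.
   Context: Set $Y=\phi(V)+U$ and let $\varrho(t)=\frac{1}{\sqrt{2\pi}}e^{-t^2/2}$. Define the continuous inverse regression $P\colon\mathbb{R}\to\mathbb{R}$ by $$P(y):=\frac{\int_{\mathbb{R}}v\,\varrho(v)\,\varrho(y-\phi(v))\,dv}{\int_{\mathbb{R}}\varrho(v)\,\varrho(y-\phi(v))\,dv},\qquad y\in\mathbb{R}.$$ It satisfies $P(Y)=\mathbb{E}[V\mid Y]$ almost surely and $P(Y)\in L^2$. The noise traders' expected loss is $$\Gamma:=\mathbb{E}\big[U\,(P(Y)-V)\big],$$ which is well defined and finite. No integrability of $\phi(V)$ is assumed. *)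

theory Defs
  imports "HOL-Probability.Probability"
begin

definition inverse_regression :: "(real \<Rightarrow> real) \<Rightarrow> real \<Rightarrow> real" where
  "inverse_regression \<phi> y =
     (\<integral>v. v * std_normal_density v * std_normal_density (y - \<phi> v) \<partial>lborel) /
     (\<integral>v. std_normal_density v * std_normal_density (y - \<phi> v) \<partial>lborel)"

text \<open>For Borel measurable \<open>\<phi>\<close> the denominator above is always positive; for independent standard
  normal \<open>U\<close> and \<open>V\<close> the integrand below is integrable. So neither the value of division by
  zero nor the default value of the Bochner integral plays a role.\<close>

definition noise_traders_loss ::
  "'a measure \<Rightarrow> ('a \<Rightarrow> real) \<Rightarrow> ('a \<Rightarrow> real) \<Rightarrow> (real \<Rightarrow> real) \<Rightarrow> real" where
  "noise_traders_loss M U V \<phi> =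
     (\<integral>\<omega>. U \<omega> * (inverse_regression \<phi> (\<phi> (V \<omega>) + U \<omega>) - V \<omega>) \<partial>M)"

end

theory Submission
  imports Defs
begin

text \<open>
  Write \<open>Y = \<phi>(V) + U\<close>, and let \<open>s\<close> be either sign, so that \<open>s * s = 1\<close>. From
  \<open>E[U V] = 0\<close>, \<open>E[U\<^sup>2] = E[V\<^sup>2] = 1\<close> and the projection property \<open>E[V P(Y)] = E[P(Y)\<^sup>2]\<close> of a
  conditional expectation, expanding the square below gives

    \<open>s \<Gamma> = 1/2 - E[(U + s V - 2 s P(Y))\<^sup>2] / 4\<close>

  (\<open>loss_mean_square\<close>). The two signs yield the two bounds, and \<open>s \<Gamma> = 1/2\<close> holds exactly when
  \<open>U + s V = 2 s P(Y)\<close> almost surely.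

  Suppose that this equation holds. For almost every \<open>v\<close> it says, with \<open>t = \<phi>(v) + u\<close> as the
  variable, that \<open>s v - \<phi>(v) = 2 s P(t) - t\<close> for almost every \<open>t\<close>. The right-hand side does not
  involve \<open>v\<close>, so \<open>s v - \<phi>(v)\<close> is almost everywhere constant (\<open>loss_eq_half_imp_affine\<close>).
  Conversely, if \<open>\<phi>(v) = s v + a\<close>, then a reflection symmetry of the joint density gives
  \<open>P(y) = s (y - a) / 2\<close> (\<open>inverse_regression_affine\<close>), and the equation holds.

  The properties of \<open>P\<close> are read off from the joint density \<open>\<rho>(v) \<rho>(y - \<phi>(v))\<close> of \<open>(Y, V)\<close>. The
  projection property is the definition of \<open>P\<close> as a quotient of integrals over \<open>v\<close>, multiplied by
  \<open>P(y)\<close> and the denominator and integrated over \<open>y\<close>. The bound \<open>E[P(Y)\<^sup>2] \<le> E[V\<^sup>2]\<close>, which makes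
  all the products integrable, comes from comparing, for each fixed \<open>y\<close>, the squared mean of \<open>V\<close>
  with its second moment.
\<close>

section \<open>The joint density of the observation and the signal\<close>

definition joint_density :: "(real \<Rightarrow> real) \<Rightarrow> real \<Rightarrow> real \<Rightarrow> real" where
  "joint_density \<phi> y v = std_normal_density v * std_normal_density (y - \<phi> v)"

lemma joint_density_pos: "0 < joint_density \<phi> y v"
  by (simp add: joint_density_def normal_density_pos)

lemma joint_density_nonneg: "0 \<le> joint_density \<phi> y v"
  using joint_density_pos less_imp_le by blast

lemma measurable_joint_density [measurable]:
  assumes [measurable]: "\<phi> \<in> borel_measurable borel"
    "f \<in> borel_measurable N" "g \<in> borel_measurable N"
  shows "(\<lambda>x. joint_density \<phi> (f x) (g x)) \<in> borel_measurable N"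
  unfolding joint_density_def by measurable

lemma AE_lborel_imp_ex:
  assumes "AE x in (lborel :: real measure). Q x"
  shows "\<exists>x. Q x"
proof -
  have "ae_filter (lborel :: real measure) \<noteq> bot"
    by (simp add: ae_filter_eq_bot_iff)
  then show ?thesis
    using eventually_happens'[OF _ assms] by blast
qed

lemma std_normal_density_le_1: "std_normal_density x \<le> 1"
proof -
  have "1 \<le> sqrt (2 * pi)"
    using pi_gt3 by (intro real_le_rsqrt) simp
  moreover have "exp (- x\<^sup>2 / 2) \<le> 1"
    by simp
  ultimately show ?thesis
    unfolding std_normal_density_def
    by (intro mult_le_one) (auto simp: field_simps)
qed

text \<open>The factor that involves \<open>\<phi>\<close> is bounded by 1, so Gaussian moments dominate.\<close>

lemma integrable_moment_joint_density:
  assumes [measurable]: "\<phi> \<in> borel_measurable borel"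
  shows "integrable lborel (\<lambda>v. v ^ k * joint_density \<phi> y v)"
proof (rule Bochner_Integration.integrable_bound[OF integrable_std_normal_moment[of k]])
  show "AE v in lborel. norm (v ^ k * joint_density \<phi> y v) \<le> norm (std_normal_density v * v ^ k)"
  proof (rule AE_I2)
    fix v :: real
    have "\<bar>std_normal_density v * v ^ k\<bar> * std_normal_density (y - \<phi> v)
        \<le> \<bar>std_normal_density v * v ^ k\<bar> * 1"
      by (intro mult_left_mono std_normal_density_le_1) simp
    then show "norm (v ^ k * joint_density \<phi> y v) \<le> norm (std_normal_density v * v ^ k)"
      by (simp add: joint_density_def abs_mult ac_simps)
  qed
qed measurable

lemma marginal_density_pos:
  assumes [measurable]: "\<phi> \<in> borel_measurable borel"
  shows "0 < (\<integral>v. joint_density \<phi> y v \<partial>lborel)"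
proof -
  have int: "integrable lborel (joint_density \<phi> y)"
    using integrable_moment_joint_density[OF assms, of 0 y] by simp
  have "(\<integral>v. joint_density \<phi> y v \<partial>lborel) \<noteq> 0"
  proof
    assume "(\<integral>v. joint_density \<phi> y v \<partial>lborel) = 0"
    then have "AE v in lborel. joint_density \<phi> y v = 0"
      using integral_nonneg_eq_0_iff_AE[OF int] joint_density_nonneg by auto
    then obtain v where "joint_density \<phi> y v = 0"
      by (blast dest: AE_lborel_imp_ex)
    then show False
      using joint_density_pos[of \<phi> y v] by simp
  qed
  moreover have "0 \<le> (\<integral>v. joint_density \<phi> y v \<partial>lborel)"
    by (intro integral_nonneg_AE AE_I2 joint_density_nonneg)
  ultimately show ?thesis
    by simp
qed

lemma inverse_regression_joint_density:
  "inverse_regression \<phi> y =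
    (\<integral>v. v * joint_density \<phi> y v \<partial>lborel) / (\<integral>v. joint_density \<phi> y v \<partial>lborel)"
  by (simp add: inverse_regression_def joint_density_def mult.assoc)

lemma inverse_regression_times_marginal:
  assumes "\<phi> \<in> borel_measurable borel"
  shows "inverse_regression \<phi> y * (\<integral>v. joint_density \<phi> y v \<partial>lborel) =
    (\<integral>v. v * joint_density \<phi> y v \<partial>lborel)"
  using marginal_density_pos[OF assms, of y] by (simp add: inverse_regression_joint_density)

lemma measurable_inverse_regression [measurable]:
  assumes [measurable]: "\<phi> \<in> borel_measurable borel"
  shows "inverse_regression \<phi> \<in> borel_measurable borel"
  unfolding inverse_regression_joint_density[abs_def] by measurable

text \<open>For fixed \<open>y\<close>, the value \<open>P(y)\<close> is the mean of the normalised density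
  \<open>joint_density \<phi> y\<close>, and a squared mean is at most the second moment because the variance is
  nonnegative.\<close>

lemma inverse_regression_second_moment_le:
  assumes [measurable]: "\<phi> \<in> borel_measurable borel"
  shows "(\<integral>v. (inverse_regression \<phi> y)\<^sup>2 * joint_density \<phi> y v \<partial>lborel)
    \<le> (\<integral>v. v\<^sup>2 * joint_density \<phi> y v \<partial>lborel)"
proof -
  define p where "p = inverse_regression \<phi> y"
  note int = integrable_moment_joint_density[OF assms, of _ y]
  have int0: "integrable lborel (joint_density \<phi> y)"
    and int1: "integrable lborel (\<lambda>v. v * joint_density \<phi> y v)"
    and int2: "integrable lborel (\<lambda>v. v\<^sup>2 * joint_density \<phi> y v)"
    using int[of 0] int[of 1] int[of 2] by simp_all
  have "0 \<le> (\<integral>v. (v - p)\<^sup>2 * joint_density \<phi> y v \<partial>lborel)"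
    by (intro integral_nonneg_AE AE_I2 mult_nonneg_nonneg joint_density_nonneg) simp
  also have "\<dots> = (\<integral>v. v\<^sup>2 * joint_density \<phi> y v - 2 * p * (v * joint_density \<phi> y v)
      + p\<^sup>2 * joint_density \<phi> y v \<partial>lborel)"
    by (simp add: power2_diff algebra_simps)
  also have "\<dots> = (\<integral>v. v\<^sup>2 * joint_density \<phi> y v \<partial>lborel)
      - 2 * p * (\<integral>v. v * joint_density \<phi> y v \<partial>lborel)
      + p\<^sup>2 * (\<integral>v. joint_density \<phi> y v \<partial>lborel)"
    using int0 int1 int2 by simp
  also have "\<dots> = (\<integral>v. v\<^sup>2 * joint_density \<phi> y v \<partial>lborel)
      - p\<^sup>2 * (\<integral>v. joint_density \<phi> y v \<partial>lborel)"
    using inverse_regression_times_marginal[OF assms, of y, folded p_def, symmetric]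
    by (simp add: power2_eq_square)
  finally show ?thesis
    by (simp add: p_def)
qed

section \<open>The inverse regression as a conditional expectation\<close>

lemma integrable_product_of_square_integrable:
  fixes f g :: "'b \<Rightarrow> real"
  assumes [measurable]: "f \<in> borel_measurable M" "g \<in> borel_measurable M"
    and "integrable M (\<lambda>\<omega>. (f \<omega>)\<^sup>2)" "integrable M (\<lambda>\<omega>. (g \<omega>)\<^sup>2)"
  shows "integrable M (\<lambda>\<omega>. f \<omega> * g \<omega>)"
proof (rule Bochner_Integration.integrable_bound)
  show "integrable M (\<lambda>\<omega>. (f \<omega>)\<^sup>2 + (g \<omega>)\<^sup>2)"
    using assms by simp
  have "\<bar>a * b\<bar> \<le> a\<^sup>2 + b\<^sup>2" for a b :: real
  proof -
    have "2 * (\<bar>a\<bar> * \<bar>b\<bar>) \<le> a\<^sup>2 + b\<^sup>2"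
      using sum_squares_bound[of "\<bar>a\<bar>" "\<bar>b\<bar>"] by (simp add: mult.assoc)
    moreover have "0 \<le> \<bar>a\<bar> * \<bar>b\<bar>"
      by simp
    ultimately show ?thesis
      unfolding abs_mult by linarith
  qed
  then show "AE \<omega> in M. norm (f \<omega> * g \<omega>) \<le> norm ((f \<omega>)\<^sup>2 + (g \<omega>)\<^sup>2)"
    by simp
qed measurable

locale normal_noise_and_signal = prob_space M for M :: "'a measure" +
  fixes U V :: "'a \<Rightarrow> real" and \<phi> :: "real \<Rightarrow> real"
  assumes U: "distributed M lborel U std_normal_density"
    and V: "distributed M lborel V std_normal_density"
    and indep: "indep_var borel U borel V"
    and meas_\<phi> [measurable]: "\<phi> \<in> borel_measurable borel"
begin

definition Y :: "'a \<Rightarrow> real" where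
  "Y \<omega> = \<phi> (V \<omega>) + U \<omega>"

abbreviation P :: "'a \<Rightarrow> real" where
  "P \<omega> \<equiv> inverse_regression \<phi> (Y \<omega>)"

lemma measurable_U [measurable]: "U \<in> borel_measurable M"
  using distributed_measurable[OF U] by simp

lemma measurable_V [measurable]: "V \<in> borel_measurable M"
  using distributed_measurable[OF V] by simp

lemma measurable_Y [measurable]: "Y \<in> borel_measurable M"
  unfolding Y_def[abs_def] by measurable

lemma distributed_U_V:
  "distributed M (lborel \<Otimes>\<^sub>M lborel) (\<lambda>\<omega>. (U \<omega>, V \<omega>))
    (\<lambda>(u, v). ennreal (std_normal_density u) * ennreal (std_normal_density v))"
proof (rule distributed_joint_indep[OF _ _ U V])
  show "indep_var lborel U lborel V"
    using indep by (simp add: indep_var_eq)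
qed unfold_locales

text \<open>For each value \<open>v\<close> of the signal, the observation is the noise translated by \<open>\<phi>(v)\<close>.\<close>

lemma distributed_Y_V:
  "distributed M (lborel \<Otimes>\<^sub>M lborel) (\<lambda>\<omega>. (Y \<omega>, V \<omega>)) (\<lambda>(y, v). joint_density \<phi> y v)"
  unfolding distributed_def
proof safe
  show "distr M (lborel \<Otimes>\<^sub>M lborel) (\<lambda>\<omega>. (Y \<omega>, V \<omega>)) =
    density (lborel \<Otimes>\<^sub>M lborel) (\<lambda>(y, v). joint_density \<phi> y v)"
  proof (rule measure_eqI)
    fix A assume "A \<in> sets (distr M (lborel \<Otimes>\<^sub>M lborel) (\<lambda>\<omega>. (Y \<omega>, V \<omega>)))"
    then have A [measurable]: "A \<in> sets (borel \<Otimes>\<^sub>M borel)"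
      by (simp cong: sets_pair_measure_cong)
    then have A': "A \<in> sets (lborel \<Otimes>\<^sub>M lborel)"
      by (simp cong: sets_pair_measure_cong)
    have "emeasure (distr M (lborel \<Otimes>\<^sub>M lborel) (\<lambda>\<omega>. (Y \<omega>, V \<omega>))) A =
        (\<integral>\<^sup>+\<omega>. indicator A (Y \<omega>, V \<omega>) \<partial>M)"
      using A' by (subst nn_integral_indicator[symmetric], simp, subst nn_integral_distr) simp_all
    also have "\<dots> = (\<integral>\<^sup>+z. (\<lambda>(u, v). ennreal (std_normal_density u) * ennreal (std_normal_density v)) z
        * (\<lambda>(u, v). indicator A (\<phi> v + u, v)) z \<partial>(lborel \<Otimes>\<^sub>M lborel))"
      using distributed_nn_integral[OF distributed_U_V, of "\<lambda>(u, v). indicator A (\<phi> v + u, v)"]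
      by (simp add: Y_def)
    also have "\<dots> = (\<integral>\<^sup>+v. \<integral>\<^sup>+u. ennreal (std_normal_density u) * ennreal (std_normal_density v)
        * indicator A (\<phi> v + u, v) \<partial>lborel \<partial>lborel)"
      by (subst lborel_pair.nn_integral_snd[symmetric]) (simp_all add: split_beta')
    also have "\<dots> = (\<integral>\<^sup>+v. \<integral>\<^sup>+y. ennreal (joint_density \<phi> y v) * indicator A (y, v) \<partial>lborel \<partial>lborel)"
    proof (rule nn_integral_cong)
      fix v :: real
      show "(\<integral>\<^sup>+u. ennreal (std_normal_density u) * ennreal (std_normal_density v)
          * indicator A (\<phi> v + u, v) \<partial>lborel) =
        (\<integral>\<^sup>+y. ennreal (joint_density \<phi> y v) * indicator A (y, v) \<partial>lborel)"
        by (subst (2) nn_integral_real_affine[where c = 1 and t = "\<phi> v"])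
          (simp_all add: joint_density_def ennreal_mult normal_density_nonneg mult.commute)
    qed
    also have "\<dots> = (\<integral>\<^sup>+z. (\<lambda>(y, v). ennreal (joint_density \<phi> y v)) z * indicator A z
        \<partial>(lborel \<Otimes>\<^sub>M lborel))"
      by (subst lborel_pair.nn_integral_snd[symmetric]) (simp_all add: split_beta')
    also have "\<dots> = emeasure (density (lborel \<Otimes>\<^sub>M lborel) (\<lambda>(y, v). joint_density \<phi> y v)) A"
      using A' by (subst emeasure_density) (simp_all add: split_beta')
    finally show "emeasure (distr M (lborel \<Otimes>\<^sub>M lborel) (\<lambda>\<omega>. (Y \<omega>, V \<omega>))) A =
      emeasure (density (lborel \<Otimes>\<^sub>M lborel) (\<lambda>(y, v). joint_density \<phi> y v)) A" .
  qed simp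
qed measurable

lemma square_integrable_P: "integrable M (\<lambda>\<omega>. (P \<omega>)\<^sup>2)"
proof (rule integrableI_nonneg)
  have V2: "integrable M (\<lambda>\<omega>. (V \<omega>)\<^sup>2)"
    using distributed_integrable[OF V, of "\<lambda>v. v\<^sup>2"] integrable_std_normal_moment[of 2] by simp
  have "(\<integral>\<^sup>+\<omega>. ennreal ((P \<omega>)\<^sup>2) \<partial>M) = (\<integral>\<^sup>+z. (\<lambda>(y, v). ennreal (joint_density \<phi> y v)) z
      * (\<lambda>(y, v). ennreal ((inverse_regression \<phi> y)\<^sup>2)) z \<partial>(lborel \<Otimes>\<^sub>M lborel))"
    using distributed_nn_integral[OF distributed_Y_V,
        of "\<lambda>(y, v). ennreal ((inverse_regression \<phi> y)\<^sup>2)"]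
    by (simp add: split_beta')
  also have "\<dots> = (\<integral>\<^sup>+y. \<integral>\<^sup>+v. ennreal ((inverse_regression \<phi> y)\<^sup>2 * joint_density \<phi> y v) \<partial>lborel \<partial>lborel)"
    by (subst lborel.nn_integral_fst[symmetric])
      (simp_all add: split_beta' ennreal_mult joint_density_nonneg mult.commute)
  also have "\<dots> \<le> (\<integral>\<^sup>+y. \<integral>\<^sup>+v. ennreal (v\<^sup>2 * joint_density \<phi> y v) \<partial>lborel \<partial>lborel)"
  proof (rule nn_integral_mono)
    fix y :: real
    have "integrable lborel (joint_density \<phi> y)"
      using integrable_moment_joint_density[OF meas_\<phi>, of 0 y] by simp
    then show "(\<integral>\<^sup>+v. ennreal ((inverse_regression \<phi> y)\<^sup>2 * joint_density \<phi> y v) \<partial>lborel) \<le>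
        (\<integral>\<^sup>+v. ennreal (v\<^sup>2 * joint_density \<phi> y v) \<partial>lborel)"
      using inverse_regression_second_moment_le[OF meas_\<phi>, of y]
        integrable_moment_joint_density[OF meas_\<phi>, of 2 y]
      by (simp add: nn_integral_eq_integral joint_density_nonneg ennreal_leI
          del: Bochner_Integration.integral_mult_right)
  qed
  also have "\<dots> = (\<integral>\<^sup>+z. (\<lambda>(y, v). ennreal (joint_density \<phi> y v)) z
      * (\<lambda>(y, v). ennreal (v\<^sup>2)) z \<partial>(lborel \<Otimes>\<^sub>M lborel))"
    by (subst lborel.nn_integral_fst[symmetric])
      (simp_all add: split_beta' ennreal_mult joint_density_nonneg mult.commute)
  also have "\<dots> = (\<integral>\<^sup>+\<omega>. ennreal ((V \<omega>)\<^sup>2) \<partial>M)"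
    using distributed_nn_integral[OF distributed_Y_V, of "\<lambda>(y, v). ennreal (v\<^sup>2)"]
    by (simp add: split_beta')
  also have "\<dots> < \<infinity>"
    using V2 by (simp add: nn_integral_eq_integral)
  finally show "(\<integral>\<^sup>+\<omega>. ennreal ((P \<omega>)\<^sup>2) \<partial>M) < \<infinity>" .
qed simp_all

lemma second_moments:
  shows integrable_U2: "integrable M (\<lambda>\<omega>. (U \<omega>)\<^sup>2)"
    and integrable_V2: "integrable M (\<lambda>\<omega>. (V \<omega>)\<^sup>2)"
    and expectation_U2: "expectation (\<lambda>\<omega>. (U \<omega>)\<^sup>2) = 1"
    and expectation_V2: "expectation (\<lambda>\<omega>. (V \<omega>)\<^sup>2) = 1"
  using distributed_integrable[OF U, of "\<lambda>v. v\<^sup>2"] distributed_integrable[OF V, of "\<lambda>v. v\<^sup>2"]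
    distributed_integral[OF U, of "\<lambda>v. v\<^sup>2"] distributed_integral[OF V, of "\<lambda>v. v\<^sup>2"]
    integrable_std_normal_moment[of 2] integral_std_normal_moment_even[of 1]
  by simp_all

lemma expectation_UV: "expectation (\<lambda>\<omega>. U \<omega> * V \<omega>) = 0"
proof -
  have "integrable M U" "integrable M V" "expectation U = 0"
    using distributed_integrable[OF U, of "\<lambda>v. v"] distributed_integrable[OF V, of "\<lambda>v. v"]
      distributed_integral[OF U, of "\<lambda>v. v"]
      integrable_std_normal_moment[of 1] integral_std_normal_moment_odd[of 0]
    by simp_all
  then show ?thesis
    using indep_var_lebesgue_integral[OF indep] by simp
qed

text \<open>The projection property: the residual \<open>V - P(Y)\<close> is orthogonal to \<open>P(Y)\<close>, since its mean
  given \<open>Y = y\<close> vanishes for every \<open>y\<close>.\<close>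

lemma expectation_VP: "expectation (\<lambda>\<omega>. V \<omega> * P \<omega>) = expectation (\<lambda>\<omega>. (P \<omega>)\<^sup>2)"
proof -
  define D where "D = (\<lambda>(y, v). (v - inverse_regression \<phi> y) * inverse_regression \<phi> y)"
  have [measurable]: "D \<in> borel_measurable (lborel \<Otimes>\<^sub>M lborel)"
    unfolding D_def by measurable
  have VP: "integrable M (\<lambda>\<omega>. V \<omega> * P \<omega>)"
    by (intro integrable_product_of_square_integrable integrable_V2 square_integrable_P) measurable
  then have "integrable M (\<lambda>\<omega>. D (Y \<omega>, V \<omega>))"
    using square_integrable_P by (simp add: D_def left_diff_distrib power2_eq_square)
  then have int: "integrable (lborel \<Otimes>\<^sub>M lborel) (\<lambda>z. (case z of (y, v) \<Rightarrow> joint_density \<phi> y v) * D z)"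
    using distributed_Y_V distributed_integrable[of M "lborel \<Otimes>\<^sub>M lborel" "\<lambda>\<omega>. (Y \<omega>, V \<omega>)"
        "\<lambda>(y, v). joint_density \<phi> y v" D]
    by (simp add: split_beta' joint_density_nonneg)
  have "expectation (\<lambda>\<omega>. D (Y \<omega>, V \<omega>)) =
      (\<integral>z. (case z of (y, v) \<Rightarrow> joint_density \<phi> y v) * D z \<partial>(lborel \<Otimes>\<^sub>M lborel))"
    using distributed_Y_V distributed_integral[of M "lborel \<Otimes>\<^sub>M lborel" "\<lambda>\<omega>. (Y \<omega>, V \<omega>)"
        "\<lambda>(y, v). joint_density \<phi> y v" D]
    by (simp add: split_beta' joint_density_nonneg)
  also have "\<dots> = (\<integral>y. \<integral>v. joint_density \<phi> y v * D (y, v) \<partial>lborel \<partial>lborel)"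
    using lborel_pair.integral_fst'[OF int] by simp
  also have "\<dots> = (\<integral>y. 0 \<partial>(lborel :: real measure))"
  proof (rule Bochner_Integration.integral_cong[OF refl])
    fix y :: real
    define p where "p = inverse_regression \<phi> y"
    have int0: "integrable lborel (joint_density \<phi> y)"
      and int1: "integrable lborel (\<lambda>v. v * joint_density \<phi> y v)"
      using integrable_moment_joint_density[OF meas_\<phi>, of 0 y]
        integrable_moment_joint_density[OF meas_\<phi>, of 1 y] by simp_all
    have "(\<integral>v. joint_density \<phi> y v * D (y, v) \<partial>lborel) =
        (\<integral>v. p * (v * joint_density \<phi> y v) - p * (p * joint_density \<phi> y v) \<partial>lborel)"
      by (simp add: D_def p_def algebra_simps)
    also have "\<dots> = p * (\<integral>v. v * joint_density \<phi> y v \<partial>lborel)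
        - p * (p * (\<integral>v. joint_density \<phi> y v \<partial>lborel))"
      using int0 int1 by simp
    also have "\<dots> = 0"
      using inverse_regression_times_marginal[OF meas_\<phi>, of y] by (simp add: p_def)
    finally show "(\<integral>v. joint_density \<phi> y v * D (y, v) \<partial>lborel) = 0" .
  qed
  finally have "expectation (\<lambda>\<omega>. V \<omega> * P \<omega> - (P \<omega>)\<^sup>2) = 0"
    by (simp add: D_def left_diff_distrib power2_eq_square)
  then show ?thesis
    using VP square_integrable_P by simp
qed

section \<open>The loss as a mean square and the bounds\<close>

text \<open>The sign \<open>s\<close> enters through \<open>s * s = 1\<close> only, so that both bounds and both equality cases
  come from one computation. The multiple \<open>2 s\<close> of \<open>P(Y)\<close> is chosen to make the terms in
  \<open>E[P(Y)\<^sup>2]\<close> cancel: the square contributes \<open>4 E[P(Y)\<^sup>2]\<close>, and the cross term with \<open>s V\<close> is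
  \<open>- 4 E[V P(Y)] = - 4 E[P(Y)\<^sup>2]\<close>.\<close>

lemma loss_mean_square:
  assumes s: "s * s = (1::real)"
  shows "s * noise_traders_loss M U V \<phi> =
      1 / 2 - expectation (\<lambda>\<omega>. (U \<omega> + s * V \<omega> - 2 * s * P \<omega>)\<^sup>2) / 4"
    and "integrable M (\<lambda>\<omega>. (U \<omega> + s * V \<omega> - 2 * s * P \<omega>)\<^sup>2)"
proof -
  have UV: "integrable M (\<lambda>\<omega>. U \<omega> * V \<omega>)"
    and UP: "integrable M (\<lambda>\<omega>. U \<omega> * P \<omega>)"
    and VP: "integrable M (\<lambda>\<omega>. V \<omega> * P \<omega>)"
    by (intro integrable_product_of_square_integrable integrable_U2 integrable_V2
        square_integrable_P; measurable)+
  note int = UV UP VP integrable_U2 integrable_V2 square_integrable_P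
  have loss: "noise_traders_loss M U V \<phi> = expectation (\<lambda>\<omega>. U \<omega> * P \<omega>)"
    using int by (simp add: noise_traders_loss_def Y_def[symmetric] right_diff_distrib expectation_UV)
  have "(u + s * v - 2 * s * p)\<^sup>2 =
      u\<^sup>2 + v\<^sup>2 + 4 * p\<^sup>2 + 2 * s * (u * v) - 4 * s * (u * p) - 4 * (v * p)" for u v p
    using s by algebra
  then have eq: "(\<lambda>\<omega>. (U \<omega> + s * V \<omega> - 2 * s * P \<omega>)\<^sup>2) =
      (\<lambda>\<omega>. (U \<omega>)\<^sup>2 + (V \<omega>)\<^sup>2 + 4 * (P \<omega>)\<^sup>2 + 2 * s * (U \<omega> * V \<omega>)
        - 4 * s * (U \<omega> * P \<omega>) - 4 * (V \<omega> * P \<omega>))"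
    by simp
  show "integrable M (\<lambda>\<omega>. (U \<omega> + s * V \<omega> - 2 * s * P \<omega>)\<^sup>2)"
    unfolding eq using int by simp
  show "s * noise_traders_loss M U V \<phi> =
      1 / 2 - expectation (\<lambda>\<omega>. (U \<omega> + s * V \<omega> - 2 * s * P \<omega>)\<^sup>2) / 4"
    unfolding eq using int
    by (simp add: loss expectation_UV expectation_VP expectation_U2 expectation_V2 diff_divide_distrib)
qed

lemma loss_le_half:
  assumes "s * s = (1::real)"
  shows "s * noise_traders_loss M U V \<phi> \<le> 1 / 2"
proof -
  have "0 \<le> expectation (\<lambda>\<omega>. (U \<omega> + s * V \<omega> - 2 * s * P \<omega>)\<^sup>2)"
    by (intro integral_nonneg_AE AE_I2) simp
  then show ?thesis
    unfolding loss_mean_square[OF assms] by linarith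
qed

lemma loss_eq_half_iff_AE:
  assumes "s * s = (1::real)"
  shows "s * noise_traders_loss M U V \<phi> = 1 / 2 \<longleftrightarrow>
    (AE \<omega> in M. U \<omega> + s * V \<omega> = 2 * s * P \<omega>)"
proof -
  have "s * noise_traders_loss M U V \<phi> = 1 / 2 \<longleftrightarrow>
      expectation (\<lambda>\<omega>. (U \<omega> + s * V \<omega> - 2 * s * P \<omega>)\<^sup>2) = 0"
    unfolding loss_mean_square(1)[OF assms] by auto
  also have "\<dots> \<longleftrightarrow> (AE \<omega> in M. (U \<omega> + s * V \<omega> - 2 * s * P \<omega>)\<^sup>2 = 0)"
    by (rule integral_nonneg_eq_0_iff_AE[OF loss_mean_square(2)[OF assms]]) simp
  finally show ?thesis
    by simp
qed

section \<open>The cases of equality\<close>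

text \<open>The normal density is positive everywhere, so \<open>(U, V)\<close> has the same null sets as Lebesgue
  measure on the plane.\<close>

lemma AE_U_V_iff_lborel:
  assumes [measurable]: "Measurable.pred (borel \<Otimes>\<^sub>M borel) (case_prod Q)"
  shows "(AE \<omega> in M. Q (V \<omega>) (U \<omega>)) \<longleftrightarrow> (AE v in lborel. AE u in lborel. Q v u)"
proof -
  have [measurable]: "(\<lambda>\<omega>. (U \<omega>, V \<omega>)) \<in> M \<rightarrow>\<^sub>M lborel \<Otimes>\<^sub>M lborel"
    by (rule distributed_measurable[OF distributed_U_V])
  have set: "{z \<in> space (lborel \<Otimes>\<^sub>M lborel). Q (snd z) (fst z)} \<in> sets (lborel \<Otimes>\<^sub>M lborel)"
    by measurable
  have "(AE \<omega> in M. Q (V \<omega>) (U \<omega>)) \<longleftrightarrow>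
      (AE z in distr M (lborel \<Otimes>\<^sub>M lborel) (\<lambda>\<omega>. (U \<omega>, V \<omega>)). Q (snd z) (fst z))"
    using set by (subst AE_distr_iff) simp_all
  also have "\<dots> \<longleftrightarrow> (AE z in lborel \<Otimes>\<^sub>M lborel. Q (snd z) (fst z))"
    unfolding distributed_distr_eq_density[OF distributed_U_V]
    by (subst AE_density)
      (auto simp: split_beta' ennreal_zero_less_mult_iff normal_density_pos)
  also have "\<dots> \<longleftrightarrow> (AE v in lborel. AE u in lborel. Q v u)"
    using lborel_pair.AE_pair_iff[OF set] lborel_pair.AE_commute[OF set] by simp
  finally show ?thesis .
qed

lemma loss_eq_half_imp_affine:
  assumes s: "s * s = (1::real)"
    and eq: "s * noise_traders_loss M U V \<phi> = 1 / 2"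
  shows "\<exists>a. AE v in lborel. \<phi> v = s * v + a"
proof -
  \<comment> \<open>Subtracting \<open>Y\<close> from \<open>U + s V = 2 s P(Y)\<close> leaves a function of \<open>V\<close> equal to one of \<open>Y\<close>.\<close>
  define g where "g t = 2 * s * inverse_regression \<phi> t - t" for t
  have [measurable]: "g \<in> borel_measurable borel"
    unfolding g_def[abs_def] by measurable
  have "AE \<omega> in M. s * V \<omega> - \<phi> (V \<omega>) = g (\<phi> (V \<omega>) + U \<omega>)"
    using eq unfolding loss_eq_half_iff_AE[OF s]
    by (rule AE_mp) (auto simp: g_def Y_def)
  then have "AE v in lborel. AE u in lborel. s * v - \<phi> v = g (\<phi> v + u)"
    by (subst (asm) AE_U_V_iff_lborel) measurable
  then have good: "AE v in lborel. AE t in lborel. s * v - \<phi> v = g t"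
  proof (rule eventually_mono)
    fix v :: real
    assume "AE u in lborel. s * v - \<phi> v = g (\<phi> v + u)"
    then show "AE t in lborel. s * v - \<phi> v = g t"
      using AE_borel_affine[of 1 "\<lambda>u. s * v - \<phi> v = g (\<phi> v + u)" "- \<phi> v"] by simp
  qed
  obtain v0 where v0: "AE t in lborel. s * v0 - \<phi> v0 = g t"
    using AE_lborel_imp_ex[OF good] by blast
  from good have "AE v in lborel. \<phi> v = s * v + (\<phi> v0 - s * v0)"
  proof (rule eventually_mono)
    fix v :: real
    assume "AE t in lborel. s * v - \<phi> v = g t"
    then obtain t where "s * v - \<phi> v = g t" "s * v0 - \<phi> v0 = g t"
      using AE_lborel_imp_ex[OF eventually_conj[OF _ v0]] by blast
    then show "\<phi> v = s * v + (\<phi> v0 - s * v0)"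
      by linarith
  qed
  then show ?thesis
    by blast
qed

end

text \<open>With \<open>\<phi>(v) = s v + a\<close> and \<open>h = s (y - a)\<close>, the joint density at \<open>y\<close> is
  \<open>\<rho>(v) \<rho>(h - v)\<close>. It is symmetric under \<open>v \<mapsto> h - v\<close>, so its mean is the centre \<open>h / 2\<close>.
  The integrals do not see the null set where \<open>\<phi>\<close> deviates from the affine function.\<close>

lemma inverse_regression_affine:
  assumes s: "s * s = (1::real)"
    and [measurable]: "\<phi> \<in> borel_measurable borel"
    and \<phi>: "AE v in lborel. \<phi> v = s * v + a"
  shows "inverse_regression \<phi> y = s * (y - a) / 2"
proof -
  define h where "h = s * (y - a)"
  define \<psi> where "\<psi> v = s * v + a" for v
  define k where "k = joint_density \<psi> y"
  have [measurable]: "\<psi> \<in> borel_measurable borel"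
    unfolding \<psi>_def[abs_def] by measurable
  have [measurable]: "k \<in> borel_measurable borel"
    unfolding k_def by measurable
  have s_cases: "s = 1 \<or> s = - 1"
    using s by (simp add: square_eq_1_iff)
  have sym: "k (h - v) = k v" for v
  proof -
    have "k v = std_normal_density v * std_normal_density (h - v)" for v
      using s_cases
      by (auto simp: k_def joint_density_def \<psi>_def h_def normal_density_def power2_commute
          algebra_simps)
    then show ?thesis by simp
  qed
  have int0: "integrable lborel k" and int1: "integrable lborel (\<lambda>v. v * k v)"
    unfolding k_def
    using integrable_moment_joint_density[of \<psi> 0 y] integrable_moment_joint_density[of \<psi> 1 y]
    by simp_all
  have "(\<integral>v. v * k v \<partial>lborel) = (\<integral>v. (h - v) * k (h - v) \<partial>lborel)"
    by (subst lborel_integral_real_affine[where c = "- 1" and t = h]) simp_all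
  also have "\<dots> = (\<integral>v. h * k v - v * k v \<partial>lborel)"
    by (simp add: sym left_diff_distrib)
  also have "\<dots> = h * (\<integral>v. k v \<partial>lborel) - (\<integral>v. v * k v \<partial>lborel)"
    using int0 int1 by simp
  finally have half: "(\<integral>v. v * k v \<partial>lborel) = h / 2 * (\<integral>v. k v \<partial>lborel)"
    by simp
  have AE_k: "AE v in lborel. joint_density \<phi> y v = k v"
    using \<phi> by eventually_elim (simp add: k_def joint_density_def \<psi>_def)
  have "(\<integral>v. joint_density \<phi> y v \<partial>lborel) = (\<integral>v. k v \<partial>lborel)"
    using AE_k by (intro integral_cong_AE) auto
  moreover have "(\<integral>v. v * joint_density \<phi> y v \<partial>lborel) = (\<integral>v. v * k v \<partial>lborel)"
    using AE_k by (intro integral_cong_AE) (auto elim!: eventually_mono)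
  ultimately show ?thesis
    using half marginal_density_pos[of \<psi> y]
    by (simp add: inverse_regression_joint_density k_def h_def)
qed

context normal_noise_and_signal
begin

lemma affine_imp_loss_eq_half:
  assumes s: "s * s = (1::real)"
    and \<phi>: "AE v in lborel. \<phi> v = s * v + a"
  shows "s * noise_traders_loss M U V \<phi> = 1 / 2"
  unfolding loss_eq_half_iff_AE[OF s]
proof -
  from \<phi> have "AE v in lborel. AE u in (lborel :: real measure). \<phi> v = s * v + a"
    by eventually_elim simp
  then have "AE \<omega> in M. \<phi> (V \<omega>) = s * V \<omega> + a"
    by (subst AE_U_V_iff_lborel) measurable
  then show "AE \<omega> in M. U \<omega> + s * V \<omega> = 2 * s * P \<omega>"
  proof eventually_elim
    case (elim \<omega>)
    have "2 * s * P \<omega> = s * s * (Y \<omega> - a)"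
      by (simp add: inverse_regression_affine[OF s meas_\<phi> \<phi>])
    with elim s show ?case
      by (simp add: Y_def)
  qed
qed

end

theorem proposition4p1:
  fixes M :: "'a measure" and U V :: "'a \<Rightarrow> real" and \<phi> :: "real \<Rightarrow> real"
  assumes "prob_space M"
    and "distributed M lborel U std_normal_density"
    and "distributed M lborel V std_normal_density"
    and "prob_space.indep_var M borel U borel V"
    and "\<phi> \<in> borel_measurable borel"
  shows "- 1 / 2 \<le> noise_traders_loss M U V \<phi> \<and> noise_traders_loss M U V \<phi> \<le> 1 / 2 \<and>
    (noise_traders_loss M U V \<phi> = 1 / 2 \<longleftrightarrow> (\<exists>a. AE v in lborel. \<phi> v = v + a)) \<and>
    (noise_traders_loss M U V \<phi> = - 1 / 2 \<longleftrightarrow> (\<exists>a. AE v in lborel. \<phi> v = - v + a))"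
proof -
  interpret normal_noise_and_signal M U V \<phi>
    using assms by (simp add: normal_noise_and_signal_def normal_noise_and_signal_axioms_def)
  have iff: "s * noise_traders_loss M U V \<phi> = 1 / 2 \<longleftrightarrow> (\<exists>a. AE v in lborel. \<phi> v = s * v + a)"
    if "s * s = 1" for s :: real
    using loss_eq_half_imp_affine[OF that] affine_imp_loss_eq_half[OF that] by blast
  have neg: "x = - 1 / 2 \<longleftrightarrow> - 1 * x = 1 / 2" for x :: real
    by auto
  have "- 1 / 2 \<le> noise_traders_loss M U V \<phi>" "noise_traders_loss M U V \<phi> \<le> 1 / 2"
    using loss_le_half[of 1] loss_le_half[of "- 1"] by simp_all
  moreover have "noise_traders_loss M U V \<phi> = 1 / 2 \<longleftrightarrow> (\<exists>a. AE v in lborel. \<phi> v = v + a)"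
    using iff[of 1] by simp
  moreover have "noise_traders_loss M U V \<phi> = - 1 / 2 \<longleftrightarrow> (\<exists>a. AE v in lborel. \<phi> v = - v + a)"
    unfolding neg using iff[of "- 1"] by simp
  ultimately show ?thesis
    by blast
qed

end
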